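(* Let $Z\in\mathbb{D}^{1,2}$ have mean $0$ and support $(-\infty,\infty)$, with a continuous density $\rho_*$. Assume that $\varliminf_{x\to\infty}g_*(x)>0$ and $\varliminf_{x\to-\infty}g_*(x)>0$, and that there is a positive $\tilde g\in\mathcal{C}^1(\mathbb{R})$ such that $0<\varliminf g_*(x)/\tilde g(x)\le\varlimsup g_*(x)/\tilde g(x)<\infty$ both as $x\to\infty$ and as $x\to-\infty$, and $\lim_{x\to\infty}\tilde g'(x)$ and $\lim_{x\to-\infty}\tilde g'(x)$ exist in $[-\infty,\infty]$. Assume that $g_*$ is twice differentiable with $g_*''(x)<2$ for all $x$, and that $$\left|\frac{x-g_*'(x)}{x^2-xg_*'(x)+g_*(x)}\right|$$ is bounded as $x\to-\infty$ and as $x\to\infty$. Then there is a finite constant $k$, depending on $Z$ alone, such that for every test function $h$ with $\|h'\|_\infty<\infty$, the solution $f=f_h$ of the Stein equation $$g_*(x)f'(x)-xf(x)=h(x)-\mathbb{E}[h(Z)],\qquad x\in\mathbb{R},$$ given by $f(x)=\frac{1}{g_*(x)\rho_*(x)}\int_{-\infty}^x\bigl(h(y)-\mathbb{E}[h(Z)]\bigr)\rho_*(y)\,dy$, satisfies $$\|f''\|_\infty\le k\,\|h'\|_\infty .$$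
   Context: Let $\mathfrak{H}$ be a real separable Hilbert space and $W$ an isonormal Gaussian process over $\mathfrak{H}$ on a probability space $(\Omega,\mathcal{F},\mathbb{P})$, with $\mathcal{F}$ generated by $W$. $D$ is the Malliavin derivative, with domain $\mathbb{D}^{1,2}\subset L^2(\Omega)$; if $F=\sum_{q\ge0}I_q(f_q)$ is the Wiener chaos decomposition, $L^{-1}F=-\sum_{q\ge1}\frac1qI_q(f_q)$. The function $g_*$ attached to $Z$ is $g_*(z)=\mathbb{E}[\langle DZ,-DL^{-1}Z\rangle_{\mathfrak{H}}\mid Z=z]$, taken in the version $g_*(z)=\frac{1}{\rho_*(z)}\int_z^\infty y\rho_*(y)\,dy$, which is strictly positive on $\mathbb{R}$. Test functions $h:\mathbb{R}\to\mathbb{R}$ are Lipschitz, hence differentiable almost everywhere, with $\|h'\|_\infty$ the (essential) supremum of $|h'|$. $f''$ is understood in the almost-everywhere sense: it is given the value $0$ wherever the second derivative of $f$ does not exist. *)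

theory Defs
  imports "HOL-Probability.Probability"
begin

definition gaussian_rv :: "'a measure \<Rightarrow> ('a \<Rightarrow> real) \<Rightarrow> bool" where
  "gaussian_rv M X \<longleftrightarrow>
     (\<exists>\<mu>. AE \<omega> in M. X \<omega> = \<mu>) \<or>
     (\<exists>\<mu> \<sigma>. \<sigma> > 0 \<and> distributed M lborel X (\<lambda>x. ennreal (normal_density \<mu> \<sigma> x)))"

text \<open>The separable Hilbert space is the type \<open>'h\<close>. A family of random variables is (jointly)
  Gaussian if all its finite linear combinations are Gaussian, constants being allowed.\<close>

locale isonormal_gaussian_process = prob_space M
  for M :: "'a measure" and W :: "'h::{real_inner, banach, second_countable_topology} \<Rightarrow> 'a \<Rightarrow> real" +
  assumes W_measurable: "\<And>u. W u \<in> borel_measurable M"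
    and W_gaussian: "\<And>S c. finite S \<Longrightarrow> gaussian_rv M (\<lambda>\<omega>. \<Sum>u\<in>S. c u * W u \<omega>)"
    and W_centered: "\<And>u. expectation (W u) = 0"
    and W_covariance: "\<And>u v. expectation (\<lambda>\<omega>. W u \<omega> * W v \<omega>) = inner u v"
    and W_generates: "sets M = sigma_sets (space M) (\<Union>u. {W u -` A \<inter> space M |A. A \<in> sets borel})"

definition L2_rv :: "'a measure \<Rightarrow> ('a \<Rightarrow> 'b::{real_normed_vector, second_countable_topology}) set" where
  "L2_rv M = {F. F \<in> borel_measurable M \<and> integrable M (\<lambda>\<omega>. (norm (F \<omega>))\<^sup>2)}"

definition L2_tendsto :: "'a measure \<Rightarrow> (nat \<Rightarrow> 'a \<Rightarrow> 'b::real_normed_vector) \<Rightarrow> ('a \<Rightarrow> 'b) \<Rightarrow> bool" where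
  "L2_tendsto M Fs F \<longleftrightarrow> (\<lambda>n. \<integral>\<^sup>+\<omega>. ennreal ((norm (Fs n \<omega> - F \<omega>))\<^sup>2) \<partial>M) \<longlonglongrightarrow> 0"

text \<open>A function on \<open>\<real>\<^sup>n\<close> is represented by a function on real sequences that only depends on
  the first \<open>n\<close> coordinates; continuity in the product topology is then continuity on \<open>\<real>\<^sup>n\<close>.\<close>

definition partial_deriv :: "nat \<Rightarrow> ((nat \<Rightarrow> real) \<Rightarrow> real) \<Rightarrow> (nat \<Rightarrow> real) \<Rightarrow> real" where
  "partial_deriv i \<phi> x = deriv (\<lambda>t. \<phi> (x(i := t))) (x i)"

text \<open>\<open>C\<^sup>\<infinity>\<close> functions on \<open>\<real>\<^sup>n\<close> which, together with all their partial derivatives, have at most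
  polynomial growth.\<close>

definition smooth_poly_growth :: "nat \<Rightarrow> ((nat \<Rightarrow> real) \<Rightarrow> real) \<Rightarrow> bool" where
  "smooth_poly_growth n \<phi> \<longleftrightarrow>
     (\<forall>x y. (\<forall>i<n. x i = y i) \<longrightarrow> \<phi> x = \<phi> y) \<and>
     (\<forall>is. set is \<subseteq> {..<n} \<longrightarrow>
        (let \<psi> = fold partial_deriv is \<phi> in
           continuous_on UNIV \<psi> \<and>
           (\<forall>i<n. \<forall>x. (\<lambda>t. \<psi> (x(i := t))) differentiable (at (x i))) \<and>
           (\<exists>C (m::nat). \<forall>x. \<bar>\<psi> x\<bar> \<le> C * (1 + (\<Sum>i<n. \<bar>x i\<bar>)) ^ m)))"

definition smooth_rv_deriv ::
  "('h::real_inner \<Rightarrow> 'a \<Rightarrow> real) \<Rightarrow> ('a \<Rightarrow> real) \<Rightarrow> ('a \<Rightarrow> 'h) \<Rightarrow> bool" where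
  "smooth_rv_deriv W F G \<longleftrightarrow>
     (\<exists>n \<phi> u. smooth_poly_growth n \<phi> \<and>
        F = (\<lambda>\<omega>. \<phi> (\<lambda>j. W (u j) \<omega>)) \<and>
        G = (\<lambda>\<omega>. \<Sum>i<n. partial_deriv i \<phi> (\<lambda>j. W (u j) \<omega>) *\<^sub>R u i))"

text \<open>The closure of the derivative of smooth random variables in \<open>L\<^sup>2(\<Omega>) \<times> L\<^sup>2(\<Omega>; 'h)\<close>; by
  closability \<open>G\<close> is almost surely determined by \<open>F\<close>.\<close>

definition has_malliavin_deriv ::
  "'a measure \<Rightarrow> ('h::{real_inner, banach, second_countable_topology} \<Rightarrow> 'a \<Rightarrow> real) \<Rightarrow>
   ('a \<Rightarrow> real) \<Rightarrow> ('a \<Rightarrow> 'h) \<Rightarrow> bool" where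
  "has_malliavin_deriv M W F G \<longleftrightarrow>
     F \<in> L2_rv M \<and> G \<in> L2_rv M \<and>
     (\<exists>Fs Gs. (\<forall>n. smooth_rv_deriv W (Fs n) (Gs n)) \<and> L2_tendsto M Fs F \<and> L2_tendsto M Gs G)"

definition D12 ::
  "'a measure \<Rightarrow> ('h::{real_inner, banach, second_countable_topology} \<Rightarrow> 'a \<Rightarrow> real) \<Rightarrow> ('a \<Rightarrow> real) set" where
  "D12 M W = {F. \<exists>G. has_malliavin_deriv M W F G}"

definition malliavin_D ::
  "'a measure \<Rightarrow> ('h::{real_inner, banach, second_countable_topology} \<Rightarrow> 'a \<Rightarrow> real) \<Rightarrow>
   ('a \<Rightarrow> real) \<Rightarrow> 'a \<Rightarrow> 'h" where
  "malliavin_D M W F = (SOME G. has_malliavin_deriv M W F G)"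

fun hermite :: "nat \<Rightarrow> real \<Rightarrow> real" where
  "hermite 0 x = 1"
| "hermite (Suc 0) x = x"
| "hermite (Suc (Suc n)) x = x * hermite (Suc n) x - real (Suc n) * hermite n x"

text \<open>The \<open>q\<close>-th Wiener chaos is the closed linear span in \<open>L\<^sup>2(\<Omega>)\<close> of the Hermite polynomials
  \<open>H\<^sub>q(W u)\<close> with \<open>u\<close> a unit vector, i.e. the set of all \<open>I\<^sub>q(f)\<close>. The disjunct \<open>q = 0\<close> only makes
  the chaos of order \<open>0\<close> consist of the constants even if \<open>'h\<close> has no unit vector.\<close>

definition wiener_chaos ::
  "'a measure \<Rightarrow> ('h::real_inner \<Rightarrow> 'a \<Rightarrow> real) \<Rightarrow> nat \<Rightarrow> ('a \<Rightarrow> real) set" where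
  "wiener_chaos M W q =
     {F. F \<in> L2_rv M \<and>
         (\<exists>Fs. (\<forall>n. \<exists>S c. finite S \<and> S \<subseteq> {u. norm u = 1 \<or> q = 0} \<and>
                     Fs n = (\<lambda>\<omega>. \<Sum>u\<in>S. c u * hermite q (W u \<omega>))) \<and>
               L2_tendsto M Fs F)}"

definition chaos_decomposition ::
  "'a measure \<Rightarrow> ('h::real_inner \<Rightarrow> 'a \<Rightarrow> real) \<Rightarrow> ('a \<Rightarrow> real) \<Rightarrow> (nat \<Rightarrow> 'a \<Rightarrow> real) \<Rightarrow> bool" where
  "chaos_decomposition M W F J \<longleftrightarrow>
     (\<forall>q. J q \<in> wiener_chaos M W q) \<and> L2_tendsto M (\<lambda>n \<omega>. \<Sum>q\<le>n. J q \<omega>) F"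

definition L_inv ::
  "'a measure \<Rightarrow> ('h::real_inner \<Rightarrow> 'a \<Rightarrow> real) \<Rightarrow> ('a \<Rightarrow> real) \<Rightarrow> 'a \<Rightarrow> real" where
  "L_inv M W F =
     (SOME G. G \<in> L2_rv M \<and>
        (\<exists>J. chaos_decomposition M W F J \<and>
             L2_tendsto M (\<lambda>n \<omega>. - (\<Sum>q=1..n. 1 / real q * J q \<omega>)) G))"

text \<open>\<open>g\<close> is the version \<open>z \<mapsto> (\<integral>\<^sub>z\<^sup>\<infinity> y \<rho>(y) dy) / \<rho>(z)\<close> of \<open>z \<mapsto> E[\<langle>DZ, -DL\<^sup>-\<^sup>1Z\<rangle> | Z = z]\<close>,
  \<open>\<rho>\<close> being the density of \<open>Z\<close>.\<close>

definition is_g_star ::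
  "'a measure \<Rightarrow> ('h::{real_inner, banach, second_countable_topology} \<Rightarrow> 'a \<Rightarrow> real) \<Rightarrow>
   ('a \<Rightarrow> real) \<Rightarrow> (real \<Rightarrow> real) \<Rightarrow> (real \<Rightarrow> real) \<Rightarrow> bool" where
  "is_g_star M W Z \<rho> g \<longleftrightarrow>
     (AE \<omega> in M. real_cond_exp M (vimage_algebra (space M) Z borel)
        (\<lambda>\<omega>. inner (malliavin_D M W Z \<omega>) (- malliavin_D M W (L_inv M W Z) \<omega>)) \<omega> = g (Z \<omega>)) \<and>
     (\<forall>z. g z = 1 / \<rho> z * (LBINT y:{z..}. y * \<rho> y)) \<and>
     (\<forall>z. g z > 0)"

definition law_support :: "'a measure \<Rightarrow> ('a \<Rightarrow> real) \<Rightarrow> real set" where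
  "law_support M Z = {x. \<forall>U. open U \<longrightarrow> x \<in> U \<longrightarrow> measure (distr M borel Z) U > 0}"

definition deriv0 :: "(real \<Rightarrow> real) \<Rightarrow> real \<Rightarrow> real" where
  "deriv0 f x = (if f differentiable (at x) then deriv f x else 0)"

definition second_deriv0 :: "(real \<Rightarrow> real) \<Rightarrow> real \<Rightarrow> real" where
  "second_deriv0 f x =
     (if (\<forall>\<^sub>F y in nhds x. f differentiable (at y)) \<and> deriv f differentiable (at x)
      then deriv (deriv f) x else 0)"

definition esssup_norm :: "(real \<Rightarrow> real) \<Rightarrow> ereal" where
  "esssup_norm u = esssup lborel (\<lambda>x. ereal \<bar>u x\<bar>)"

definition sup_norm :: "(real \<Rightarrow> real) \<Rightarrow> ereal" where
  "sup_norm u = (SUP x. ereal \<bar>u x\<bar>)"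

definition stein_solution ::
  "'a measure \<Rightarrow> ('a \<Rightarrow> real) \<Rightarrow> (real \<Rightarrow> real) \<Rightarrow> (real \<Rightarrow> real) \<Rightarrow> (real \<Rightarrow> real) \<Rightarrow> real \<Rightarrow> real" where
  "stein_solution M Z \<rho> g h x =
     1 / (g x * \<rho> x) * (LBINT y:{..x}. (h y - (\<integral>\<omega>. h (Z \<omega>) \<partial>M)) * \<rho> y)"

end

theory Submission
  imports Defs
begin

text \<open>
  Write \<open>\<phi> = g \<rho>\<close> with \<open>\<rho>\<close> the density of \<open>Z\<close>, so that \<open>\<phi> x\<close> is the integral of \<open>y \<rho> y\<close> over
  \<open>y \<ge> x\<close> and \<open>\<phi>' = - x \<rho>\<close>, and let \<open>\<Phi>\<close> be the distribution function of \<open>Z\<close>. Differentiating the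
  Stein equation gives \<open>g f'' = f + h' + (x - g') f'\<close>, and the three terms on the right have to be
  bounded by a multiple of \<open>L g\<close>, where \<open>L\<close> is the essential supremum of \<open>\<bar>h'\<bar>\<close>. A Lipschitz
  function is an indefinite integral of its almost everywhere derivative, so \<open>L\<close> is a Lipschitz
  constant of \<open>h\<close> and \<open>\<bar>h'\<bar> \<le> L\<close> wherever \<open>h'\<close> exists.

  Splitting the mean of \<open>h\<close> at \<open>x\<close> expresses \<open>f\<close> and \<open>g f'\<close> through the integrals \<open>p\<close> of
  \<open>(h x - h y) \<rho> y\<close> over \<open>y \<le> x\<close> and \<open>r\<close> of \<open>(h y - h x) \<rho> y\<close> over \<open>y > x\<close>. They are bounded by
  \<open>L b\<close> and \<open>L a\<close>, where \<open>b = \<phi> + x \<Phi>\<close> and \<open>a = \<phi> - x (1 - \<Phi>)\<close> are the values for \<open>h y = y\<close>. This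
  yields \<open>\<bar>f\<bar> \<le> L\<close> and \<open>\<bar>g f'\<bar> \<le> 2 L a b / \<phi>\<close> (\<open>abs_solution_le\<close>, \<open>abs_solution_equation_le\<close>).

  The product \<open>a b\<close> is controlled by a Mills ratio inequality. Let \<open>q = x\<^sup>2 - x g' + g\<close>. As
  \<open>q' = x (2 - g'')\<close>, the condition \<open>g'' < 2\<close> makes \<open>q\<close> minimal at \<open>0\<close>, hence \<open>q \<ge> g 0 > 0\<close>. The
  same condition makes \<open>\<Phi> + \<phi> (x - g') / q\<close> increasing, because its derivative is
  \<open>\<rho> g\<^sup>2 (2 - g'') / q\<^sup>2\<close>. Since \<open>\<phi>\<close> vanishes at both ends, the assumed boundedness of
  \<open>(x - g') / q\<close> identifies its limits as \<open>0\<close> and \<open>1\<close>, so it stays between them (\<open>mills_bounds\<close>;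
  for \<open>g = 1\<close> this is the Gaussian bound by \<open>x / (x\<^sup>2 + 1)\<close>). It follows that \<open>a \<le> \<phi> g / q\<close> for
  \<open>x \<ge> 0\<close> and \<open>b \<le> \<phi> g / q\<close> for \<open>x \<le> 0\<close>, whence \<open>\<bar>f'\<bar> \<le> 2 L (\<phi> + \<bar>x\<bar>) / q\<close>.

  In \<open>(x - g') f' / g\<close> the part with \<open>\<phi>\<close> is bounded since \<open>\<phi>\<close> and \<open>(x - g') / q\<close> are bounded and
  \<open>g\<close> is bounded away from \<open>0\<close>. For the part with \<open>\<bar>x\<bar>\<close>, the identity \<open>x (x - g') = q - g\<close> gives
  \<open>\<bar>x (x - g')\<bar> / (g q) = \<bar>1 / g - 1 / q\<bar>\<close>, which is bounded as well.
\<close>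

section \<open>Lipschitz functions and the essential supremum of the derivative\<close>

text \<open>The image of Lebesgue measure under \<open>inv F\<close> gives \<open>{a..b}\<close> the mass \<open>F b - F a\<close>. It is
  absolutely continuous because Lipschitz maps preserve null sets, and its Radon-Nikodym density
  is the wanted integrand. The lower bound on the slopes makes \<open>F\<close> a bijection.\<close>

lemma strictly_increasing_Lipschitz_antiderivative:
  fixes F :: "real \<Rightarrow> real"
  assumes lip: "K-lipschitz_on UNIV F"
    and slope: "\<And>x y. x \<le> y \<Longrightarrow> y - x \<le> F y - F x"
  obtains u where "\<And>a b. a \<le> b \<Longrightarrow> (u has_integral (F b - F a)) {a..b}"
proof -
  have cont: "continuous_on UNIV F"
    using lip by (rule lipschitz_on_continuous_on)
  have smono: "strict_mono F"
    unfolding strict_mono_def using slope by (smt (verit))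
  have inj: "inj F" using smono by (rule strict_mono_imp_inj_on)
  have surj: "surj F"
  proof (unfold surj_def, intro allI)
    fix y
    define r where "r = \<bar>y - F 0\<bar>"
    have "F (-r) \<le> y" "y \<le> F r"
      using slope[of "-r" 0] slope[of 0 r] by (auto simp: r_def)
    moreover have "-r \<le> r" by (simp add: r_def)
    ultimately show "\<exists>x. y = F x"
      using IVT'[of F "-r" y r] continuous_on_subset[OF cont] by blast
  qed
  have inv_iff: "inv F y \<le> x \<longleftrightarrow> y \<le> F x" for x y
    using smono surj by (metis strict_mono_less_eq surj_f_inv_f)
  have inv_iff': "x \<le> inv F y \<longleftrightarrow> F x \<le> y" for x y
    using smono surj by (metis strict_mono_less_eq surj_f_inv_f)
  have "mono (inv F)"
    by (rule monoI) (metis inv_iff' order_trans order_refl)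
  then have [measurable]: "inv F \<in> borel_measurable borel"
    by (rule borel_measurable_mono)
  define \<nu> where "\<nu> = distr lborel borel (inv F)"
  have vimage: "inv F -` A = F ` A" for A
    using inj surj by (metis bij_betw_def bij_vimage_eq_inv_image bij_imp_bij_inv inv_inv_eq)
  have ac: "absolutely_continuous lborel \<nu>"
    unfolding absolutely_continuous_def
  proof
    fix A assume A: "A \<in> null_sets (lborel :: real measure)"
    then have neg: "negligible A"
      by (simp add: negligible_iff_null_sets null_sets_completionI)
    have Ab: "A \<in> sets borel" using A by (auto simp: null_sets_def)
    have "negligible (F ` A)"
    proof (rule negligible_locally_Lipschitz_image[OF _ neg])
      show "\<exists>T B. open T \<and> x \<in> T \<and> (\<forall>y \<in> A \<inter> T. norm (F y - F x) \<le> B * norm (y - x))" for x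
        using lip by (intro exI[of _ UNIV] exI[of _ K]) (auto simp: lipschitz_on_def dist_norm)
    qed simp
    then have "inv F -` A \<in> null_sets lebesgue"
      by (simp add: vimage negligible_iff_null_sets)
    moreover have "inv F -` A \<in> sets lborel"
      using measurable_sets_borel[OF \<open>inv F \<in> borel_measurable borel\<close> Ab] by simp
    ultimately have "inv F -` A \<in> null_sets lborel"
      using null_sets_completion_iff by blast
    then show "A \<in> null_sets \<nu>"
      using Ab by (auto simp: \<nu>_def null_sets_def emeasure_distr)
  qed
  obtain v where v[measurable]: "v \<in> borel_measurable lborel" and v\<nu>: "density lborel v = \<nu>"
    using sigma_finite_measure.Radon_Nikodym[OF sigma_finite_lborel ac] by (auto simp: \<nu>_def)
  have nn: "(\<integral>\<^sup>+x. v x * indicator {a..b} x \<partial>lborel) = ennreal (F b - F a)" if "a \<le> b" for a b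
  proof -
    have "(\<integral>\<^sup>+x. v x * indicator {a..b} x \<partial>lborel) = emeasure \<nu> {a..b}"
      unfolding v\<nu>[symmetric] by (subst emeasure_density) auto
    also have "\<dots> = emeasure lborel (inv F -` {a..b})"
      by (simp add: \<nu>_def emeasure_distr)
    also have "inv F -` {a..b} = {F a..F b}"
      by (auto simp: inv_iff inv_iff')
    finally show ?thesis
      using slope[OF that] that by simp
  qed
  define u where "u x = enn2real (v x)" for x
  have [measurable]: "u \<in> borel_measurable lborel" unfolding u_def by measurable
  show ?thesis
  proof (rule that)
    fix a b :: real assume ab: "a \<le> b"
    have "AE x in lborel. v x * indicator {a..b} x \<noteq> \<infinity>"
      by (rule nn_integral_PInf_AE) (use nn[OF ab] in \<open>auto\<close>)
    then have "(\<integral>\<^sup>+x. ennreal (u x * indicator {a..b} x) \<partial>lborel) = (\<integral>\<^sup>+x. v x * indicator {a..b} x \<partial>lborel)"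
      by (intro nn_integral_cong_AE, elim eventually_mono)
         (auto simp: u_def indicator_def less_top)
    then have "((\<lambda>x. u x * indicator {a..b} x) has_integral (F b - F a)) UNIV"
      using nn[OF ab] slope[OF ab] ab
      by (intro nn_integral_has_integral) (auto simp: u_def)
    moreover have "(\<lambda>x. u x * indicator {a..b} x) = (\<lambda>x. if x \<in> {a..b} then u x else 0)"
      by (auto simp: indicator_def)
    ultimately show "(u has_integral (F b - F a)) {a..b}"
      by (simp only: has_integral_restrict_UNIV)
  qed
qed

text \<open>Rademacher's theorem on the line, together with the fundamental theorem of calculus. Adding
  \<open>(C + 1) x\<close> to \<open>h\<close> makes all slopes at least \<open>1\<close>, so the previous lemma provides an integrand.
  Almost everywhere it is the limit of its averages over shrinking intervals to the right;
  averages to the left are obtained from the reflected integrand.\<close>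

lemma Lipschitz_AE_differentiable:
  fixes h :: "real \<Rightarrow> real"
  assumes lip: "C-lipschitz_on UNIV h"
  obtains w N where "negligible N"
    and "\<And>x. x \<notin> N \<Longrightarrow> (h has_real_derivative w x) (at x)"
    and "\<And>a b. a \<le> b \<Longrightarrow> (w has_integral (h b - h a)) {a..b}"
proof -
  define F where "F x = h x + (C + 1) * x" for x
  have hl: "\<bar>h y - h x\<bar> \<le> C * (y - x)" if "x \<le> y" for x y
    using lipschitz_onD[OF lip, of y x] that by (simp add: dist_real_def)
  have "(C + \<bar>C + 1\<bar> * 1)-lipschitz_on UNIV F"
    unfolding F_def
    by (rule lipschitz_on_add[OF lip lipschitz_on_cmult_real[OF lipschitz_on_id]])
  moreover have "y - x \<le> F y - F x" if "x \<le> y" for x y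
    using hl[OF that] by (simp add: F_def algebra_simps abs_le_iff)
  ultimately obtain u where u: "\<And>a b. a \<le> b \<Longrightarrow> (u has_integral (F b - F a)) {a..b}"
    using strictly_increasing_Lipschitz_antiderivative[of _ F] by metis
  have "u integrable_on cbox a b" for a b
    using u[of a b] by (cases "a \<le> b") (auto simp: has_integral_iff)
  then obtain N1 where N1: "negligible N1"
    "\<And>x e. \<lbrakk>x \<notin> N1; 0 < e\<rbrakk> \<Longrightarrow> \<exists>d>0. \<forall>t. 0 < t \<and> t < d \<longrightarrow>
       norm (integral (cbox x (x + t *\<^sub>R One)) u /\<^sub>R t ^ DIM(real) - u x) < e"
    using integrable_ccontinuous_explicit[of u] by metis
  have refl: "((\<lambda>x. u (- x)) has_integral (F (-a) - F (-b))) {a..b}" if "a \<le> b" for a b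
    using u[of "-b" "-a"] that has_integral_reflect_real[of u "F (-a) - F (-b)" "-a" "-b"] by simp
  have "(\<lambda>x. u (-x)) integrable_on cbox a b" for a b
    using refl[of a b] by (cases "a \<le> b") (auto simp: has_integral_iff)
  then obtain N2 where N2: "negligible N2"
    "\<And>x e. \<lbrakk>x \<notin> N2; 0 < e\<rbrakk> \<Longrightarrow> \<exists>d>0. \<forall>t. 0 < t \<and> t < d \<longrightarrow>
       norm (integral (cbox x (x + t *\<^sub>R One)) (\<lambda>x. u (-x)) /\<^sub>R t ^ DIM(real) - u (-x)) < e"
    using integrable_ccontinuous_explicit[of "\<lambda>x. u (-x)"] by metis
  define N where "N = N1 \<union> uminus ` N2"
  have "negligible (uminus ` N2)"
  proof (rule negligible_locally_Lipschitz_image[OF _ N2(1)])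
    show "\<exists>T B. open T \<and> x \<in> T \<and> (\<forall>y \<in> N2 \<inter> T. norm (- y - - x) \<le> B * norm (y - x))" for x
      by (intro exI[of _ UNIV] exI[of _ 1]) auto
  qed simp
  then have "negligible N" using N1(1) by (simp add: N_def)
  moreover have "(h has_real_derivative (u x - (C + 1))) (at x)" if x: "x \<notin> N" for x
  proof -
    have x1: "x \<notin> N1" and x2: "-x \<notin> N2"
      using x by (auto simp: N_def image_iff)
    \<comment> \<open>Right difference quotients are averages of \<open>u\<close>; left ones are averages of the reflected
      \<open>u\<close> at \<open>- x\<close>.\<close>
    have "((\<lambda>t. (F (x + t) - F x) / t) \<longlongrightarrow> u x) (at 0)"
    proof (rule LIM_I)
      fix e :: real assume e: "0 < e"
      from N1(2)[OF x1 e] obtain d1 where d1: "d1 > 0" "\<And>t. 0 < t \<Longrightarrow> t < d1 \<Longrightarrow>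
         norm (integral {x..x + t} u / t - u x) < e" by (auto simp: divide_inverse mult.commute)
      from N2(2)[OF x2 e] obtain d2 where d2: "d2 > 0" "\<And>t. 0 < t \<Longrightarrow> t < d2 \<Longrightarrow>
         norm (integral {-x..-x + t} (\<lambda>x. u (-x)) / t - u x) < e" by (auto simp: divide_inverse mult.commute)
      have "norm ((F (x + t) - F x) / t - u x) < e" if t: "t \<noteq> 0" "norm t < min d1 d2" for t
      proof (cases "t > 0")
        case True
        then show ?thesis
          using d1(2)[of t] u[of x "x + t"] t by (simp add: integral_unique)
      next
        case False
        then have "0 < -t" "-t < d2" using t by auto
        from d2(2)[OF this] refl[of "-x" "-x + (-t)"] False
        have "norm ((F x - F (x + t)) / (-t) - u x) < e" by (simp add: integral_unique add.commute)
        moreover have "(F x - F (x + t)) / (-t) = (F (x + t) - F x) / t"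
          by (simp add: diff_divide_distrib)
        ultimately show ?thesis by simp
      qed
      then show "\<exists>s>0. \<forall>t. t \<noteq> 0 \<and> norm (t - 0) < s \<longrightarrow> norm ((F (x + t) - F x) / t - u x) < e"
        using d1 d2 by (intro exI[of _ "min d1 d2"]) auto
    qed
    then have "(F has_real_derivative u x) (at x)"
      by (simp add: DERIV_def)
    then have "((\<lambda>y. F y - (C + 1) * y) has_real_derivative (u x - (C + 1))) (at x)"
      by (auto intro!: derivative_eq_intros)
    then show ?thesis by (simp add: F_def)
  qed
  moreover have "((\<lambda>x. u x - (C + 1)) has_integral (h b - h a)) {a..b}" if "a \<le> b" for a b
    using has_integral_diff[OF u[OF that] has_integral_const_real[of "C + 1" a b]] that
    by (simp add: F_def algebra_simps)
  ultimately show ?thesis by (rule that)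
qed

text \<open>As \<open>deriv0\<close> vanishes where the derivative does not exist, the bound on it is informative
  only because a Lipschitz function is differentiable almost everywhere.\<close>

lemma Lipschitz_bound_from_AE_derivative_bound:
  fixes h :: "real \<Rightarrow> real"
  assumes lip: "C-lipschitz_on UNIV h"
    and AE: "AE x in lborel. \<bar>deriv0 h x\<bar> \<le> L"
    and L: "0 \<le> L"
  shows "\<bar>h y - h x\<bar> \<le> L * \<bar>y - x\<bar>"
proof -
  obtain w N where N: "negligible N"
    and w: "\<And>x. x \<notin> N \<Longrightarrow> (h has_real_derivative w x) (at x)"
    and int: "\<And>a b. a \<le> b \<Longrightarrow> (w has_integral (h b - h a)) {a..b}"
    using Lipschitz_AE_differentiable[OF lip] by metis
  from AE have "AE x in lebesgue. \<bar>deriv0 h x\<bar> \<le> L"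
    by (rule AE_completion)
  then obtain N' where N': "N' \<in> null_sets lebesgue" "{x. \<not> \<bar>deriv0 h x\<bar> \<le> L} \<subseteq> N'"
    by (auto simp: eventually_ae_filter)
  have neg: "negligible (N \<union> N')"
    using N N'(1) by (intro negligible_Un) (simp_all add: negligible_iff_null_sets)
  have *: "\<bar>h b - h a\<bar> \<le> L * (b - a)" if "a \<le> b" for a b
  proof -
    have "((\<lambda>x. if x \<in> N \<union> N' then 0 else w x) has_integral (h b - h a)) {a..b}"
      by (rule has_integral_spike[OF neg _ int[OF that]]) auto
    moreover have "norm (if x \<in> N \<union> N' then 0 else w x) \<le> L" for x
    proof (cases "x \<in> N \<union> N'")
      case False
      then have d: "(h has_real_derivative w x) (at x)" using w by auto
      then have "deriv0 h x = w x"
        by (auto simp: deriv0_def DERIV_imp_deriv real_differentiable_def)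
      moreover have "\<bar>deriv0 h x\<bar> \<le> L" using False N' by auto
      ultimately show ?thesis using False by auto
    qed (use L in auto)
    ultimately show ?thesis
      using has_integral_bound_real[OF L finite.emptyI, of "\<lambda>x. if x \<in> N \<union> N' then 0 else w x" "h b - h a" a b] that
      by (simp add: content_real)
  qed
  show ?thesis
    using *[of x y] *[of y x] by (cases "x \<le> y") (auto simp: abs_minus_commute)
qed

lemma abs_derivative_le_Lipschitz_constant:
  fixes h :: "real \<Rightarrow> real"
  assumes lip: "\<And>x y. \<bar>h y - h x\<bar> \<le> L * \<bar>y - x\<bar>"
    and d: "(h has_real_derivative d) (at x)"
  shows "\<bar>d\<bar> \<le> L"
proof (rule tendsto_upperbound)
  show "((\<lambda>t. \<bar>(h (x + t) - h x) / t\<bar>) \<longlongrightarrow> \<bar>d\<bar>) (at 0)"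
    using d by (intro tendsto_rabs) (simp add: DERIV_def)
  show "\<forall>\<^sub>F t in at 0. \<bar>(h (x + t) - h x) / t\<bar> \<le> L"
    unfolding eventually_at_filter
  proof (intro always_eventually allI impI)
    fix t :: real assume "t \<noteq> 0"
    then show "\<bar>(h (x + t) - h x) / t\<bar> \<le> L"
      using lip[of "x + t" x] by (simp add: abs_divide divide_simps)
  qed
qed simp

text \<open>An essential supremum is nonnegative here only because Lebesgue measure is not the zero
  measure.\<close>

lemma esssup_norm_eq_real:
  assumes "esssup_norm u < \<infinity>"
  obtains L where "0 \<le> L" "esssup_norm u = ereal L" "AE x in lborel. \<bar>u x\<bar> \<le> L"
proof -
  have AE: "AE x in lborel. ereal \<bar>u x\<bar> \<le> esssup_norm u"
    unfolding esssup_norm_def by (rule esssup_AE)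
  have "0 \<le> esssup_norm u"
  proof (rule ccontr)
    assume neg: "\<not> 0 \<le> esssup_norm u"
    have "AE x in lborel :: real measure. False"
    proof (rule eventually_mono[OF AE])
      fix x assume "ereal \<bar>u x\<bar> \<le> esssup_norm u"
      then have "0 \<le> esssup_norm u" by (rule order_trans[rotated]) simp
      then show False using neg by simp
    qed
    then have "emeasure lborel (space (lborel :: real measure)) = 0"
      unfolding ae_filter_eq_bot_iff[symmetric] trivial_limit_def .
    then show False by simp
  qed
  then obtain L where L: "esssup_norm u = ereal L" "0 \<le> L"
    using assms by (cases "esssup_norm u") auto
  show ?thesis by (rule that[OF L(2,1)]) (use AE L in simp)
qed

section \<open>Bounds on the whole line from bounds at its ends\<close>

lemma continuous_bounded_if_Bfun_at_ends:
  fixes f :: "real \<Rightarrow> real"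
  assumes cont: "continuous_on UNIV f" and top: "Bfun f at_top" and bot: "Bfun f at_bot"
  obtains B where "\<And>x. \<bar>f x\<bar> \<le> B"
proof -
  obtain K1 where K1: "\<forall>\<^sub>F x in at_top. norm (f x) \<le> K1" using top by (auto elim: BfunE)
  obtain K2 where K2: "\<forall>\<^sub>F x in at_bot. norm (f x) \<le> K2" using bot by (auto elim: BfunE)
  obtain b where b: "\<And>x. x \<ge> b \<Longrightarrow> norm (f x) \<le> K1" using K1 by (auto simp: eventually_at_top_linorder)
  obtain a where a: "\<And>x. x \<le> a \<Longrightarrow> norm (f x) \<le> K2" using K2 by (auto simp: eventually_at_bot_linorder)
  have "compact (f ` {a..b})"
    by (intro compact_continuous_image continuous_on_subset[OF cont]) auto
  then obtain K3 where "\<And>y. y \<in> f ` {a..b} \<Longrightarrow> norm y \<le> K3"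
    by (meson bounded_iff compact_imp_bounded)
  then have "\<bar>f x\<bar> \<le> max K1 (max K2 K3)" for x
    using a[of x] b[of x] by (cases "x \<le> a"; cases "b \<le> x") (auto simp: le_max_iff_disj)
  then show ?thesis by (rule that)
qed

text \<open>The reciprocal \<open>1 / g\<close> is continuous and bounded at both ends, hence bounded.\<close>

lemma positive_lower_bound_if_Liminf_pos:
  fixes g :: "real \<Rightarrow> real"
  assumes cont: "continuous_on UNIV g" and pos: "\<And>x. 0 < g x"
    and top: "Liminf at_top (\<lambda>x. ereal (g x)) > 0" and bot: "Liminf at_bot (\<lambda>x. ereal (g x)) > 0"
  obtains c where "0 < c" "\<And>x. c \<le> g x"
proof -
  have B: "Bfun (\<lambda>x. 1 / g x) F" if "Liminf F (\<lambda>x. ereal (g x)) > 0" for F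
  proof -
    obtain y where y: "0 < y" "y < Liminf F (\<lambda>x. ereal (g x))"
      using dense[OF \<open>0 < Liminf F _\<close>] by auto
    from less_LiminfD[OF y(2)] have "\<forall>\<^sub>F x in F. y < ereal (g x)" .
    moreover obtain r where r: "y = ereal r" "0 < r"
      using y by (cases y) auto
    ultimately have "\<forall>\<^sub>F x in F. norm (1 / g x) \<le> 1 / r"
      by (auto elim!: eventually_mono simp: pos abs_of_pos frac_le)
    then show ?thesis by (rule BfunI)
  qed
  have "continuous_on UNIV (\<lambda>x. 1 / g x)"
    using pos by (intro continuous_intros cont) (metis less_irrefl)
  then obtain K where K: "\<And>x. \<bar>1 / g x\<bar> \<le> K"
    using continuous_bounded_if_Bfun_at_ends[OF _ B[OF top] B[OF bot]] by metis
  have Kpos: "0 < K" using K[of 0] pos[of 0] by (smt (verit) divide_pos_pos)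
  show ?thesis
  proof (rule that)
    show "0 < 1 / K" using Kpos by simp
    show "1 / K \<le> g x" for x
      using K[of x] pos[of x] Kpos by (simp add: divide_simps mult.commute)
  qed
qed

section \<open>Partial moments of a centred density\<close>

abbreviation lower_integral :: "(real \<Rightarrow> real) \<Rightarrow> real \<Rightarrow> real" where
  "lower_integral k x \<equiv> (LBINT y:{..x}. k y)"

lemma integrable_imp_set_integrable:
  fixes k :: "real \<Rightarrow> real"
  assumes "integrable lborel k" "A \<in> sets borel"
  shows "set_integrable lborel A k"
  unfolding set_integrable_def by (rule integrable_mult_indicator) (use assms in auto)

lemma lower_integral_add_upper:
  fixes k :: "real \<Rightarrow> real"
  assumes "integrable lborel k"
  shows "(LBINT y:{x<..}. k y) = integral\<^sup>L lborel k - lower_integral k x"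
proof -
  have "integral\<^sup>L lborel k = (LBINT y:{..x} \<union> {x<..}. k y)"
    unfolding set_lebesgue_integral_def
    by (rule Bochner_Integration.integral_cong) (auto simp: indicator_def)
  also have "\<dots> = lower_integral k x + (LBINT y:{x<..}. k y)"
    by (rule set_integral_Un) (auto intro!: integrable_imp_set_integrable assms)
  finally show ?thesis by simp
qed

lemma upper_integral_closed_eq_open:
  fixes k :: "real \<Rightarrow> real"
  assumes "integrable lborel k"
  shows "(LBINT y:{x..}. k y) = (LBINT y:{x<..}. k y)"
  unfolding set_lebesgue_integral_def
proof (rule integral_cong_AE)
  have [measurable]: "k \<in> borel_measurable borel" using assms by auto
  show "(\<lambda>y. indicat_real {x..} y *\<^sub>R k y) \<in> borel_measurable lborel"
    "(\<lambda>y. indicat_real {x<..} y *\<^sub>R k y) \<in> borel_measurable lborel" by measurable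
  show "AE y in lborel. indicat_real {x..} y *\<^sub>R k y = indicat_real {x<..} y *\<^sub>R k y"
    using AE_lborel_singleton[of x] by eventually_elim (auto simp: indicator_def)
qed

lemma lower_integral_has_derivative:
  assumes int: "integrable lborel k" and cont: "continuous_on UNIV k"
  shows "((\<lambda>x. lower_integral k x) has_real_derivative k x) (at x)"
proof -
  \<comment> \<open>The fundamental theorem of calculus applies on compact intervals; any base point left of
    \<open>x\<close> would do.\<close>
  define a where "a = x - 1"
  have eq: "lower_integral k y = lower_integral k a + integral {a..y} k" if "a < y" for y
  proof -
    have "lower_integral k y = (LBINT t:{..a} \<union> {a<..y}. k t)"
      using that by (intro arg_cong[where f="\<lambda>A. set_lebesgue_integral lborel A k"]) auto
    also have "\<dots> = lower_integral k a + (LBINT t:{a<..y}. k t)"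
      by (rule set_integral_Un) (auto simp: integrable_imp_set_integrable[OF int])
    also have "(LBINT t:{a<..y}. k t) = integral {a<..y} k"
      by (rule set_borel_integral_eq_integral(2)[OF integrable_imp_set_integrable[OF int]]) simp
    also have "\<dots> = integral {a..y} k"
    proof (rule integral_subset_negligible)
      have "{a..y} - {a<..y} \<subseteq> {a}" by auto
      then show "negligible ({a..y} - {a<..y})" by (rule negligible_subset[OF negligible_sing])
    qed auto
    finally show ?thesis .
  qed
  have "((\<lambda>y. integral {a..y} k) has_real_derivative k x) (at x within {a..x+1})"
    by (rule integral_has_real_derivative) (auto intro: continuous_on_subset[OF cont] simp: a_def)
  then have "((\<lambda>y. integral {a..y} k) has_real_derivative k x) (at x)"
    by (subst (asm) at_within_interior) (auto simp: a_def)
  then have "((\<lambda>y. lower_integral k a + integral {a..y} k) has_real_derivative k x) (at x)"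
    by (auto intro!: derivative_eq_intros)
  moreover have "\<forall>\<^sub>F y in nhds x. lower_integral k y = lower_integral k a + integral {a..y} k"
    using eq by (intro eventually_nhds_in_open[of "{a<..}" x, THEN eventually_mono]) (auto simp: a_def)
  ultimately show ?thesis
    by (subst DERIV_cong_ev[OF refl _ refl])
qed

lemma lower_integral_tendsto_at_top:
  fixes k :: "real \<Rightarrow> real"
  assumes "integrable lborel k"
  shows "(lower_integral k \<longlongrightarrow> integral\<^sup>L lborel k) at_top"
  unfolding set_lebesgue_integral_def by (rule tendsto_integral_at_top) (use assms in auto)

lemma lower_integral_tendsto_at_bot:
  fixes k :: "real \<Rightarrow> real"
  assumes int: "integrable lborel k"
  shows "(lower_integral k \<longlongrightarrow> 0) at_bot"
proof -
  have [measurable]: "k \<in> borel_measurable borel" using int by auto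
  define s where "s i y = indicator {..- i} y * k y" for i y :: real
  have s_meas: "s i \<in> borel_measurable lborel" for i unfolding s_def by measurable
  have s_bound: "norm (s i y) \<le> \<bar>k y\<bar>" for i y
    by (auto simp: s_def indicator_def)
  have s_lim: "((\<lambda>i. s i y) \<longlongrightarrow> 0) at_top" for y
  proof (rule tendsto_eventually)
    have "\<forall>\<^sub>F i in at_top. - y < i" by (rule eventually_gt_at_top)
    then show "\<forall>\<^sub>F i in at_top. s i y = 0"
      by eventually_elim (simp add: s_def indicator_def)
  qed
  have "((\<lambda>i. integral\<^sup>L lborel (s i)) \<longlongrightarrow> integral\<^sup>L lborel (\<lambda>_::real. 0 :: real)) at_top"
  proof (rule integral_dominated_convergence_at_top)
    show "integrable lborel (\<lambda>y. \<bar>k y\<bar>)" using int by (rule integrable_abs)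
    show "AE y in lborel. ((\<lambda>i. s i y) \<longlongrightarrow> 0) at_top" using s_lim by (intro AE_I2)
    show "\<forall>\<^sub>F i in at_top. AE y in lborel. norm (s i y) \<le> \<bar>k y\<bar>"
      using s_bound by (intro always_eventually allI AE_I2)
    show "(\<lambda>_. 0) \<in> borel_measurable lborel" by (rule borel_measurable_const)
    show "s i \<in> borel_measurable lborel" for i by (rule s_meas)
  qed
  also have "(\<lambda>i. integral\<^sup>L lborel (s i)) = (\<lambda>i. lower_integral k (- i))"
    by (simp add: s_def set_lebesgue_integral_def cong: Bochner_Integration.integral_cong)
  finally show ?thesis
    by (subst filterlim_at_bot_mirror) simp
qed

lemma abs_lower_integral_le:
  fixes k :: "real \<Rightarrow> real"
  assumes int: "integrable lborel k"
  shows "\<bar>lower_integral k x\<bar> \<le> (\<integral>y. \<bar>k y\<bar> \<partial>lborel)"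
  unfolding set_lebesgue_integral_def
proof (rule integral_abs_bound_integral)
  show "integrable lborel (\<lambda>y. indicator {..x} y *\<^sub>R k y)"
    using integrable_imp_set_integrable[OF int, of "{..x}"] by (simp add: set_integrable_def)
  show "integrable lborel (\<lambda>y. \<bar>k y\<bar>)" using int by (rule integrable_abs)
qed (simp add: indicator_def)

locale centred_density =
  fixes \<rho> :: "real \<Rightarrow> real"
  assumes nonneg: "\<And>x. 0 \<le> \<rho> x"
    and cont: "continuous_on UNIV \<rho>"
    and integrable: "integrable lborel \<rho>"
    and total: "integral\<^sup>L lborel \<rho> = 1"
    and moment_integrable: "integrable lborel (\<lambda>y. y * \<rho> y)"
    and centred: "integral\<^sup>L lborel (\<lambda>y. y * \<rho> y) = 0"
begin

definition lower_mass :: "real \<Rightarrow> real" where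
  "lower_mass x = lower_integral \<rho> x"

definition tail_moment :: "real \<Rightarrow> real" where
  "tail_moment x = (LBINT y:{x..}. y * \<rho> y)"

text \<open>The integrals of \<open>(x - y) \<rho> y\<close> over \<open>y \<le> x\<close> and of \<open>(y - x) \<rho> y\<close> over \<open>y > x\<close>, equivalently
  the areas under the distribution function left of \<open>x\<close> and under its complement right of \<open>x\<close>.
  They are written through \<open>tail_moment\<close> because all later estimates compare them with it.\<close>

definition lower_area :: "real \<Rightarrow> real" where
  "lower_area x = tail_moment x + x * lower_mass x"

definition upper_area :: "real \<Rightarrow> real" where
  "upper_area x = tail_moment x - x * (1 - lower_mass x)"

text \<open>For a centred density the moment above \<open>x\<close> is minus the moment below \<open>x\<close>; the latter form
  gives the derivative and both limits.\<close>

lemma tail_moment_eq: "tail_moment x = - lower_integral (\<lambda>y. y * \<rho> y) x"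
  using lower_integral_add_upper[OF moment_integrable, of x]
    upper_integral_closed_eq_open[OF moment_integrable, of x]
  by (simp add: tail_moment_def centred)

lemma lower_mass_has_derivative: "(lower_mass has_real_derivative \<rho> x) (at x)"
  unfolding lower_mass_def using lower_integral_has_derivative[OF integrable cont] .

lemma tail_moment_has_derivative: "(tail_moment has_real_derivative - x * \<rho> x) (at x)"
  unfolding tail_moment_eq
  using lower_integral_has_derivative[OF moment_integrable continuous_on_mult[OF continuous_on_id cont]]
  by (auto intro!: derivative_eq_intros)

lemma tail_moment_tendsto:
  "(tail_moment \<longlongrightarrow> 0) at_bot" "(tail_moment \<longlongrightarrow> 0) at_top"
  unfolding tail_moment_eq
  using tendsto_minus[OF lower_integral_tendsto_at_bot[OF moment_integrable]]
    tendsto_minus[OF lower_integral_tendsto_at_top[OF moment_integrable]]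
  by (simp_all add: centred)

lemma lower_mass_tendsto: "(lower_mass \<longlongrightarrow> 0) at_bot" "(lower_mass \<longlongrightarrow> 1) at_top"
  unfolding lower_mass_def
  using lower_integral_tendsto_at_bot[OF integrable] lower_integral_tendsto_at_top[OF integrable]
  by (simp_all add: total)

lemma lower_mass_nonneg: "0 \<le> lower_mass x" and lower_mass_le_1: "lower_mass x \<le> 1"
proof -
  show "0 \<le> lower_mass x"
    unfolding lower_mass_def set_lebesgue_integral_def by (intro integral_nonneg_AE) (auto simp: nonneg)
  have "0 \<le> (LBINT y:{x<..}. \<rho> y)"
    unfolding set_lebesgue_integral_def by (intro integral_nonneg_AE) (auto simp: nonneg)
  then show "lower_mass x \<le> 1"
    using lower_integral_add_upper[OF integrable, of x] by (simp add: total lower_mass_def)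
qed

lemma Lipschitz_integrable:
  assumes lip: "\<And>x y. \<bar>h y - h x\<bar> \<le> L * \<bar>y - x\<bar>" and h[measurable]: "h \<in> borel_measurable borel"
  shows "integrable lborel (\<lambda>y. h y * \<rho> y)"
proof (rule Bochner_Integration.integrable_bound)
  have [measurable]: "\<rho> \<in> borel_measurable borel" using integrable by auto
  show "integrable lborel (\<lambda>y. \<bar>h 0\<bar> * \<rho> y + L * \<bar>y * \<rho> y\<bar>)"
    using integrable moment_integrable by auto
  show "(\<lambda>y. h y * \<rho> y) \<in> borel_measurable lborel" by measurable
  have "\<bar>h y * \<rho> y\<bar> \<le> \<bar>h 0\<bar> * \<rho> y + L * \<bar>y * \<rho> y\<bar>" for y
  proof -
    have "\<bar>h y\<bar> \<le> \<bar>h 0\<bar> + L * \<bar>y\<bar>" using lip[of y 0] by simp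
    from mult_right_mono[OF this nonneg[of y]] show ?thesis
      by (simp add: abs_mult nonneg algebra_simps)
  qed
  then show "AE y in lborel. norm (h y * \<rho> y) \<le> norm (\<bar>h 0\<bar> * \<rho> y + L * \<bar>y * \<rho> y\<bar>)"
    by (intro AE_I2) (auto intro: order_trans[OF _ abs_ge_self])
qed

text \<open>Inside the absolute value is the integral of \<open>(h x - h y) \<rho> y\<close> over \<open>y \<le> x\<close>; the Lipschitz
  condition compares it with the same integral for \<open>y \<mapsto> L y\<close>. The lemma \<open>upper_gap\<close> below is the
  counterpart over \<open>y > x\<close>.\<close>

lemma lower_gap:
  assumes lip: "\<And>x y. \<bar>h y - h x\<bar> \<le> L * \<bar>y - x\<bar>"
    and int: "integrable lborel (\<lambda>y. h y * \<rho> y)"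
  shows "\<bar>h x * lower_mass x - lower_integral (\<lambda>y. h y * \<rho> y) x\<bar> \<le> L * lower_area x"
proof -
  have i\<rho>: "set_integrable lborel {..x} (\<lambda>y. c * \<rho> y)" for c
    by (intro set_integrable_mult_right impI integrable_imp_set_integrable[OF integrable]) simp
  have im: "set_integrable lborel {..x} (\<lambda>y. y * \<rho> y)"
    by (rule integrable_imp_set_integrable[OF moment_integrable]) simp
  have ih: "set_integrable lborel {..x} (\<lambda>y. h y * \<rho> y)"
    by (rule integrable_imp_set_integrable[OF int]) simp
  note si1 = set_integral_diff(1)[OF i\<rho>[of "h x"] ih]
  have si2: "set_integrable lborel {..x} (\<lambda>y. L * (x * \<rho> y - y * \<rho> y))"
    by (intro set_integrable_mult_right impI set_integral_diff(1)[OF i\<rho> im])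
  have "h x * lower_mass x - lower_integral (\<lambda>y. h y * \<rho> y) x = lower_integral (\<lambda>y. h x * \<rho> y - h y * \<rho> y) x"
    unfolding set_integral_diff(2)[OF i\<rho>[of "h x"] ih] by (simp add: lower_mass_def)
  moreover have "L * lower_area x = lower_integral (\<lambda>y. L * (x * \<rho> y - y * \<rho> y)) x"
    unfolding set_integral_mult_right set_integral_diff(2)[OF i\<rho>[of x] im]
    by (simp add: lower_area_def tail_moment_eq lower_mass_def)
  moreover have "\<bar>lower_integral (\<lambda>y. h x * \<rho> y - h y * \<rho> y) x\<bar> \<le> lower_integral (\<lambda>y. L * (x * \<rho> y - y * \<rho> y)) x"
    unfolding set_lebesgue_integral_def
  proof (rule integral_abs_bound_integral)
    fix y
    have "\<bar>h x * \<rho> y - h y * \<rho> y\<bar> \<le> L * (x * \<rho> y - y * \<rho> y)" if "y \<le> x"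
    proof -
      have "\<bar>h x * \<rho> y - h y * \<rho> y\<bar> = \<bar>h x - h y\<bar> * \<rho> y"
        by (simp add: left_diff_distrib[symmetric] abs_mult nonneg)
      also have "\<dots> \<le> L * \<bar>x - y\<bar> * \<rho> y"
        by (rule mult_right_mono[OF lip nonneg])
      also have "\<dots> = L * (x * \<rho> y - y * \<rho> y)"
        using that by (simp add: left_diff_distrib[symmetric])
      finally show ?thesis .
    qed
    then show "\<bar>indicator {..x} y *\<^sub>R (h x * \<rho> y - h y * \<rho> y)\<bar>
        \<le> indicator {..x} y *\<^sub>R (L * (x * \<rho> y - y * \<rho> y))"
      by (auto simp: indicator_def)
  qed (use si1 si2 in \<open>auto simp: set_integrable_def\<close>)
  ultimately show ?thesis by (simp only:)
qed

lemma upper_gap: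
  assumes lip: "\<And>x y. \<bar>h y - h x\<bar> \<le> L * \<bar>y - x\<bar>"
    and int: "integrable lborel (\<lambda>y. h y * \<rho> y)"
  shows "\<bar>(integral\<^sup>L lborel (\<lambda>y. h y * \<rho> y) - lower_integral (\<lambda>y. h y * \<rho> y) x) - h x * (1 - lower_mass x)\<bar>
    \<le> L * upper_area x"
proof -
  have i\<rho>: "set_integrable lborel {x<..} (\<lambda>y. c * \<rho> y)" for c
    by (intro set_integrable_mult_right impI integrable_imp_set_integrable[OF integrable]) simp
  have im: "set_integrable lborel {x<..} (\<lambda>y. y * \<rho> y)"
    by (rule integrable_imp_set_integrable[OF moment_integrable]) simp
  have ih: "set_integrable lborel {x<..} (\<lambda>y. h y * \<rho> y)"
    by (rule integrable_imp_set_integrable[OF int]) simp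
  note si1 = set_integral_diff(1)[OF ih i\<rho>[of "h x"]]
  have si2: "set_integrable lborel {x<..} (\<lambda>y. L * (y * \<rho> y - x * \<rho> y))"
    by (intro set_integrable_mult_right impI set_integral_diff(1)[OF im i\<rho>])
  note up = lower_integral_add_upper[symmetric]
  have c: "1 - lower_mass x = (LBINT y:{x<..}. \<rho> y)"
    using up[OF integrable, of x] by (simp add: total lower_mass_def)
  have t: "tail_moment x = (LBINT y:{x<..}. y * \<rho> y)"
    by (simp add: tail_moment_def upper_integral_closed_eq_open[OF moment_integrable])
  have "(integral\<^sup>L lborel (\<lambda>y. h y * \<rho> y) - lower_integral (\<lambda>y. h y * \<rho> y) x) - h x * (1 - lower_mass x)
     = (LBINT y:{x<..}. h y * \<rho> y - h x * \<rho> y)"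
    unfolding set_integral_diff(2)[OF ih i\<rho>[of "h x"]] c up[OF int] by simp
  moreover have "L * upper_area x = (LBINT y:{x<..}. L * (y * \<rho> y - x * \<rho> y))"
    unfolding set_integral_mult_right set_integral_diff(2)[OF im i\<rho>[of x]] upper_area_def c t
    by simp
  moreover have "\<bar>LBINT y:{x<..}. h y * \<rho> y - h x * \<rho> y\<bar> \<le> (LBINT y:{x<..}. L * (y * \<rho> y - x * \<rho> y))"
    unfolding set_lebesgue_integral_def
  proof (rule integral_abs_bound_integral)
    fix y
    have "\<bar>h y * \<rho> y - h x * \<rho> y\<bar> \<le> L * (y * \<rho> y - x * \<rho> y)" if "x < y"
    proof -
      have "\<bar>h y * \<rho> y - h x * \<rho> y\<bar> = \<bar>h y - h x\<bar> * \<rho> y"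
        by (simp add: left_diff_distrib[symmetric] abs_mult nonneg)
      also have "\<dots> \<le> L * \<bar>y - x\<bar> * \<rho> y"
        by (rule mult_right_mono[OF lip nonneg])
      also have "\<dots> = L * (y * \<rho> y - x * \<rho> y)"
        using that by (simp add: left_diff_distrib[symmetric])
      finally show ?thesis .
    qed
    then show "\<bar>indicator {x<..} y *\<^sub>R (h y * \<rho> y - h x * \<rho> y)\<bar>
        \<le> indicator {x<..} y *\<^sub>R (L * (y * \<rho> y - x * \<rho> y))"
      by (auto simp: indicator_def)
  qed (use si1 si2 in \<open>auto simp: set_integrable_def\<close>)
  ultimately show ?thesis by (simp only:)
qed

text \<open>Nonnegativity of both areas is the case \<open>h = 0\<close>, \<open>L = 1\<close> of the gap estimates.\<close>

lemma lower_area_nonneg: "0 \<le> lower_area x"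
  using lower_gap[of "\<lambda>_. 0" 1 x] by (simp add: set_lebesgue_integral_def)

lemma upper_area_nonneg: "0 \<le> upper_area x"
  using upper_gap[of "\<lambda>_. 0" 1 x] by (simp add: set_lebesgue_integral_def)

end

section \<open>The Stein solution and its first derivative\<close>

locale stein_density = centred_density +
  fixes g :: "real \<Rightarrow> real"
  assumes g_pos: "\<And>x. 0 < g x"
    and density_pos: "\<And>x. 0 < \<rho> x"
    and g_density: "\<And>x. tail_moment x = g x * \<rho> x"
begin

lemma tail_moment_pos: "0 < tail_moment x"
  by (simp add: g_density g_pos density_pos)

definition mean :: "(real \<Rightarrow> real) \<Rightarrow> real" where
  "mean h = integral\<^sup>L lborel (\<lambda>y. h y * \<rho> y)"

definition numerator :: "(real \<Rightarrow> real) \<Rightarrow> real \<Rightarrow> real" where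
  "numerator h x = lower_integral (\<lambda>y. (h y - mean h) * \<rho> y) x"

definition solution :: "(real \<Rightarrow> real) \<Rightarrow> real \<Rightarrow> real" where
  "solution h x = numerator h x / tail_moment x"

lemma numerator_eq:
  assumes int: "integrable lborel (\<lambda>y. h y * \<rho> y)"
  shows "numerator h x = lower_integral (\<lambda>y. h y * \<rho> y) x - mean h * lower_mass x"
proof -
  have i: "set_integrable lborel {..x} (\<lambda>y. h y * \<rho> y)"
    by (rule integrable_imp_set_integrable[OF int]) simp
  have r: "set_integrable lborel {..x} (\<lambda>y. mean h * \<rho> y)"
    by (intro set_integrable_mult_right impI integrable_imp_set_integrable[OF integrable]) simp
  show ?thesis
    unfolding numerator_def left_diff_distrib set_integral_diff(2)[OF i r]
    by (simp add: lower_mass_def)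
qed

text \<open>This is the Stein equation, solved for the derivative: \<open>\<phi>' = - x \<rho>\<close> for \<open>\<phi> = g \<rho>\<close> makes
  \<open>\<phi>\<close> the integrating factor.\<close>

lemma solution_has_derivative:
  assumes int: "integrable lborel (\<lambda>y. h y * \<rho> y)" and h: "continuous_on UNIV h"
  shows "(solution h has_real_derivative (x * solution h x + h x - mean h) / g x) (at x)"
proof -
  have "integrable lborel (\<lambda>y. (h y - mean h) * \<rho> y)"
    using int integrable by (simp add: left_diff_distrib)
  then have num: "(numerator h has_real_derivative (h x - mean h) * \<rho> x) (at x)"
    unfolding numerator_def[abs_def]
    by (rule lower_integral_has_derivative) (intro continuous_intros h cont)
  have "(solution h has_real_derivative
      ((h x - mean h) * \<rho> x * tail_moment x - numerator h x * (- x * \<rho> x)) / (tail_moment x * tail_moment x)) (at x)"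
    unfolding solution_def[abs_def]
    using tail_moment_pos[of x] by (intro DERIV_divide num tail_moment_has_derivative) simp
  also have "((h x - mean h) * \<rho> x * tail_moment x - numerator h x * (- x * \<rho> x)) / (tail_moment x * tail_moment x)
      = (x * solution h x + h x - mean h) / g x"
    using g_pos[of x] density_pos[of x]
    by (simp add: solution_def g_density divide_simps) (simp add: algebra_simps)
  finally show ?thesis .
qed

text \<open>The equality case \<open>h y = y\<close> of the bound on the solution, where \<open>f = - 1\<close>.\<close>

lemma area_balance:
  "(1 - lower_mass x) * lower_area x + lower_mass x * upper_area x = tail_moment x"
  by (simp add: lower_area_def upper_area_def algebra_simps)

text \<open>With \<open>p\<close> and \<open>r\<close> the two gaps, the numerator of the solution is \<open>- ((1 - \<Phi>) p + \<Phi> r)\<close>, and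
  \<open>h x\<close> minus the mean is \<open>p - r\<close>. Inserting the gap estimates, the first bound reduces to
  \<open>area_balance\<close>, and in the second one \<open>p\<close> and \<open>r\<close> appear with coefficients proportional to
  \<open>upper_area x\<close> and \<open>- lower_area x\<close>.\<close>

lemma
  assumes lip: "\<And>x y. \<bar>h y - h x\<bar> \<le> L * \<bar>y - x\<bar>"
    and int: "integrable lborel (\<lambda>y. h y * \<rho> y)"
  shows abs_solution_le: "\<bar>solution h x\<bar> \<le> L"
    and abs_solution_equation_le:
      "\<bar>x * solution h x + h x - mean h\<bar> \<le> 2 * L * (lower_area x * upper_area x) / tail_moment x"
proof -
  define p where "p = h x * lower_mass x - lower_integral (\<lambda>y. h y * \<rho> y) x"
  define r where "r = mean h - lower_integral (\<lambda>y. h y * \<rho> y) x - h x * (1 - lower_mass x)"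
  have p: "\<bar>p\<bar> \<le> L * lower_area x" unfolding p_def by (rule lower_gap[OF lip int])
  have r: "\<bar>r\<bar> \<le> L * upper_area x" unfolding r_def mean_def by (rule upper_gap[OF lip int])
  note pos = tail_moment_pos[of x]
  have num: "numerator h x = - ((1 - lower_mass x) * p + lower_mass x * r)"
    by (simp add: numerator_eq[OF int] p_def r_def algebra_simps)
  have "\<bar>numerator h x\<bar> \<le> (1 - lower_mass x) * \<bar>p\<bar> + lower_mass x * \<bar>r\<bar>"
    unfolding num abs_minus_cancel
    by (rule order_trans[OF abs_triangle_ineq]) (simp add: abs_mult lower_mass_nonneg lower_mass_le_1)
  also have "\<dots> \<le> (1 - lower_mass x) * (L * lower_area x) + lower_mass x * (L * upper_area x)"
    by (intro add_mono mult_left_mono p r) (auto simp: lower_mass_nonneg lower_mass_le_1)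
  also have "\<dots> = L * tail_moment x"
    by (simp flip: area_balance add: distrib_left mult.left_commute)
  finally show "\<bar>solution h x\<bar> \<le> L"
    using pos by (simp add: solution_def divide_simps)
  have "x * numerator h x + (h x - mean h) * tail_moment x = p * upper_area x - r * lower_area x"
  proof -
    have hm: "h x - mean h = p - r" by (simp add: p_def r_def algebra_simps)
    show ?thesis unfolding hm num by (simp add: lower_area_def upper_area_def algebra_simps)
  qed
  moreover have "\<bar>p * upper_area x - r * lower_area x\<bar> \<le> L * lower_area x * upper_area x + L * upper_area x * lower_area x"
  proof -
    have "\<bar>p * upper_area x - r * lower_area x\<bar> \<le> \<bar>p\<bar> * upper_area x + \<bar>r\<bar> * lower_area x"
      using abs_triangle_ineq4[of "p * upper_area x" "r * lower_area x"]
      by (simp add: abs_mult lower_area_nonneg upper_area_nonneg)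
    also have "\<dots> \<le> L * lower_area x * upper_area x + L * upper_area x * lower_area x"
      by (intro add_mono mult_right_mono p r lower_area_nonneg upper_area_nonneg)
    finally show ?thesis .
  qed
  ultimately have "\<bar>x * numerator h x + (h x - mean h) * tail_moment x\<bar> \<le> 2 * L * (lower_area x * upper_area x)"
    by (simp add: algebra_simps)
  moreover have "x * solution h x + h x - mean h = (x * numerator h x + (h x - mean h) * tail_moment x) / tail_moment x"
    using pos by (simp add: solution_def divide_simps) (simp add: algebra_simps)
  ultimately show "\<bar>x * solution h x + h x - mean h\<bar> \<le> 2 * L * (lower_area x * upper_area x) / tail_moment x"
    using pos by (simp add: abs_divide divide_right_mono)
qed

end

section \<open>A Mills ratio inequality and the second derivative\<close>

locale smooth_stein_density = stein_density +
  fixes g1 g2 :: "real \<Rightarrow> real"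
  assumes g_deriv: "\<And>x. (g has_real_derivative g1 x) (at x)"
    and g1_deriv: "\<And>x. (g1 has_real_derivative g2 x) (at x)"
    and g2_less: "\<And>x. g2 x < 2"
begin

text \<open>The denominator in the assumed bound; for the standard Gaussian, where \<open>g = 1\<close>, it is
  \<open>x\<^sup>2 + 1\<close>.\<close>

definition q :: "real \<Rightarrow> real" where
  "q x = x\<^sup>2 - x * g1 x + g x"

lemma q_has_derivative: "(q has_real_derivative x * (2 - g2 x)) (at x)"
  unfolding q_def[abs_def]
  by (rule derivative_eq_intros g_deriv g1_deriv refl)+ (simp add: algebra_simps)

text \<open>The derivative \<open>x (2 - g2 x)\<close> has the sign of \<open>x\<close>, so \<open>q\<close> is minimal at \<open>0\<close>.\<close>

lemma q_ge: "g 0 \<le> q x"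
proof -
  have "q 0 \<le> q x"
  proof (cases "0 \<le> x")
    case True
    then show ?thesis
      by (rule DERIV_nonneg_imp_nondecreasing)
         (metis q_has_derivative g2_less less_eq_real_def diff_gt_0_iff_gt mult_nonneg_nonneg)
  next
    case False
    then have "x \<le> 0" by simp
    then show ?thesis
      by (rule DERIV_nonpos_imp_nonincreasing)
         (metis q_has_derivative g2_less less_eq_real_def diff_gt_0_iff_gt mult_nonpos_nonneg)
  qed
  then show ?thesis by (simp add: q_def)
qed

lemma q_pos: "0 < q x"
  using q_ge[of x] g_pos[of 0] by linarith

text \<open>For \<open>g = 1\<close> this is the density times \<open>x / (x\<^sup>2 + 1)\<close>, the classical lower bound for the
  Gaussian upper tail. The same function, negated, is a lower bound for the lower tail, which
  matters for negative \<open>x\<close>.\<close>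

definition mills :: "real \<Rightarrow> real" where
  "mills x = tail_moment x * ((x - g1 x) / q x)"

text \<open>Everything cancels except one square, because \<open>x (x - g1 x) = q x - g x\<close>.\<close>

lemma mass_plus_mills_has_derivative:
  "((\<lambda>x. lower_mass x + mills x) has_real_derivative \<rho> x * (g x)\<^sup>2 * (2 - g2 x) / (q x)\<^sup>2) (at x)"
proof -
  define s where "s = x - g1 x"
  \<comment> \<open>Eliminating \<open>g1 x\<close> in favour of \<open>s\<close> turns the claim into a polynomial identity.\<close>
  have q: "q x = x * s + g x" by (simp add: q_def s_def power2_eq_square algebra_simps)
  have "((\<lambda>x. lower_mass x + mills x) has_real_derivative
      \<rho> x + ((- x * \<rho> x) * ((x - g1 x) / q x) +
        ((1 - g2 x) * q x - (x - g1 x) * (x * (2 - g2 x))) / (q x * q x) * tail_moment x)) (at x)"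
    unfolding mills_def
    using q_pos[of x]
    by (intro DERIV_add DERIV_mult DERIV_divide DERIV_diff DERIV_ident
        lower_mass_has_derivative tail_moment_has_derivative g1_deriv q_has_derivative) simp
  also have "\<rho> x + ((- x * \<rho> x) * ((x - g1 x) / q x) +
        ((1 - g2 x) * q x - (x - g1 x) * (x * (2 - g2 x))) / (q x * q x) * tail_moment x)
      = \<rho> x * (g x)\<^sup>2 * (2 - g2 x) / (q x)\<^sup>2"
    unfolding g_density s_def[symmetric]
    using q_pos[of x] unfolding q
    by (simp add: divide_simps power2_eq_square) (simp add: algebra_simps)
  finally show ?thesis .
qed

end

locale bounded_stein_density = smooth_stein_density +
  fixes B c :: real
  assumes ratio_bound: "\<And>x. \<bar>(x - g1 x) / q x\<bar> \<le> B"
    and c_pos: "0 < c" and c_le: "\<And>x. c \<le> g x"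
begin

lemma q_ge_c: "c \<le> q x"
  using q_ge[of x] c_le[of 0] by simp

lemma mills_tendsto:
  assumes "(tail_moment \<longlongrightarrow> 0) F"
  shows "(mills \<longlongrightarrow> 0) F"
proof (rule Lim_null_comparison)
  show "\<forall>\<^sub>F x in F. norm (mills x) \<le> \<bar>tail_moment x\<bar> * B"
    using ratio_bound unfolding mills_def
    by (intro always_eventually allI) (simp only: real_norm_def abs_mult mult_left_mono abs_ge_zero)
  show "((\<lambda>x. \<bar>tail_moment x\<bar> * B) \<longlongrightarrow> 0) F"
    by (intro tendsto_mult_left_zero tendsto_rabs_zero assms)
qed

text \<open>A monotone function lies between its limits at the two ends.\<close>

lemma mills_bounds: "0 \<le> lower_mass x + mills x" "lower_mass x + mills x \<le> 1"
proof -
  let ?T = "\<lambda>x. lower_mass x + mills x"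
  have mono: "?T a \<le> ?T b" if "a \<le> b" for a b
  proof (rule DERIV_nonneg_imp_nondecreasing[OF that], intro exI conjI)
    show "(?T has_real_derivative \<rho> y * (g y)\<^sup>2 * (2 - g2 y) / (q y)\<^sup>2) (at y)" for y
      by (rule mass_plus_mills_has_derivative)
    show "0 \<le> \<rho> y * (g y)\<^sup>2 * (2 - g2 y) / (q y)\<^sup>2" for y
      using nonneg[of y] g2_less[of y] by simp
  qed
  have "(?T \<longlongrightarrow> 0 + 0) at_bot"
    by (intro tendsto_add lower_mass_tendsto mills_tendsto tail_moment_tendsto)
  then show "0 \<le> ?T x"
    using tendsto_upperbound[of ?T 0 at_bot "?T x"] eventually_mono[OF eventually_le_at_bot[of x] mono]
    by simp
  have "(?T \<longlongrightarrow> 1 + 0) at_top"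
    by (intro tendsto_add lower_mass_tendsto mills_tendsto tail_moment_tendsto)
  then show "?T x \<le> 1"
    using tendsto_lowerbound[of ?T 1 at_top "?T x"] eventually_mono[OF eventually_ge_at_top[of x] mono]
    by simp
qed

lemma tail_moment_minus_mills: "tail_moment x - x * mills x = tail_moment x * g x / q x"
proof -
  have "x * (x - g1 x) = q x - g x" by (simp add: q_def power2_eq_square algebra_simps)
  then have "x * mills x = tail_moment x * (q x - g x) / q x"
    by (simp add: mills_def mult.left_commute)
  then show ?thesis using q_pos[of x] by (simp add: divide_simps algebra_simps)
qed

text \<open>The area beyond \<open>x\<close>, seen from \<open>0\<close>, is small by the Mills bounds, and the other one grows at
  most linearly.\<close>

lemma areas_le: "lower_area x * upper_area x \<le> tail_moment x * g x / q x * (tail_moment x + \<bar>x\<bar>)"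
proof (cases "0 \<le> x")
  case True
  have "upper_area x \<le> tail_moment x - x * mills x"
    unfolding upper_area_def using mills_bounds(2)[of x] True by (simp add: mult_left_mono)
  moreover have "lower_area x \<le> tail_moment x + \<bar>x\<bar>"
    unfolding lower_area_def using True lower_mass_le_1[of x] by (simp add: mult_left_le)
  ultimately have "upper_area x * lower_area x \<le> (tail_moment x - x * mills x) * (tail_moment x + \<bar>x\<bar>)"
    using upper_area_nonneg[of x] lower_area_nonneg[of x] by (intro mult_mono) auto
  then show ?thesis by (simp add: tail_moment_minus_mills mult.commute)
next
  case False
  then have x: "x \<le> 0" by simp
  have "lower_area x \<le> tail_moment x - x * mills x"
    unfolding lower_area_def using mult_left_mono_neg[OF _ x, of "- mills x" "lower_mass x"] mills_bounds(1)[of x]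
    by simp
  moreover have "upper_area x \<le> tail_moment x + \<bar>x\<bar>"
    unfolding upper_area_def using mult_left_mono_neg[OF _ x, of "1 - lower_mass x" 1] x lower_mass_nonneg[of x]
    by simp
  ultimately have "lower_area x * upper_area x \<le> (tail_moment x - x * mills x) * (tail_moment x + \<bar>x\<bar>)"
    using upper_area_nonneg[of x] lower_area_nonneg[of x] by (intro mult_mono) auto
  then show ?thesis by (simp add: tail_moment_minus_mills)
qed

text \<open>Bounding \<open>\<bar>x - g1 x\<bar> / q x\<close> by \<open>B\<close> in the summand with \<open>\<bar>x\<bar>\<close> would leave the possibly
  unbounded factor \<open>\<bar>x\<bar> / g x\<close>. Instead \<open>x (x - g1 x) = q x - g x\<close> turns that summand into
  \<open>\<bar>1 / g x - 1 / q x\<bar>\<close>.\<close>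

lemma deriv_coefficient_bound: "\<bar>x - g1 x\<bar> / g x * ((tail_moment x + \<bar>x\<bar>) / q x) \<le> (B * tail_moment x + 1) / c"
proof -
  note pos = g_pos[of x] q_pos[of x] c_pos tail_moment_pos[of x]
  have r: "\<bar>x - g1 x\<bar> / q x \<le> B"
    using ratio_bound[of x] q_pos[of x] by (simp add: abs_divide)
  have "\<bar>x - g1 x\<bar> / q x * tail_moment x / g x \<le> B * tail_moment x / c"
    using r pos c_le[of x] order_trans[OF _ r, of 0] by (intro frac_le mult_right_mono) auto
  moreover have "\<bar>x - g1 x\<bar> * \<bar>x\<bar> / (q x * g x) \<le> 1 / c"
  proof -
    have "\<bar>x - g1 x\<bar> * \<bar>x\<bar> = \<bar>q x - g x\<bar>"
      by (simp add: abs_mult[symmetric] q_def power2_eq_square algebra_simps)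
    also have "\<dots> \<le> max (q x) (g x)" using pos by auto
    also have "\<dots> \<le> q x * g x / c"
    proof -
      have "c * q x \<le> q x * g x" "c * g x \<le> q x * g x"
        using c_le[of x] q_ge_c[of x] pos by (auto simp: mult.commute)
      then show ?thesis using pos by (simp add: pos_le_divide_eq mult.commute)
    qed
    finally show ?thesis using pos by (simp add: divide_simps mult_ac)
  qed
  moreover have "\<bar>x - g1 x\<bar> / g x * ((tail_moment x + \<bar>x\<bar>) / q x)
    = \<bar>x - g1 x\<bar> / q x * tail_moment x / g x + \<bar>x - g1 x\<bar> * \<bar>x\<bar> / (q x * g x)"
    using pos by (simp add: divide_simps distrib_left mult_ac)
  ultimately show ?thesis by (simp add: add_divide_distrib)
qed

text \<open>Here \<open>u\<close> is \<open>f'\<close> and \<open>d\<close> is \<open>h'\<close>, so the left-hand side is \<open>\<bar>f''\<bar>\<close> by the differentiated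
  Stein equation. In the constant, \<open>f + h'\<close> accounts for \<open>2 / c\<close> and the term with \<open>f'\<close> for
  \<open>2 (B T + 1) / c\<close>.\<close>

lemma second_derivative_bound:
  assumes lip: "\<And>x y. \<bar>h y - h x\<bar> \<le> L * \<bar>y - x\<bar>"
    and int: "integrable lborel (\<lambda>y. h y * \<rho> y)"
    and tail: "tail_moment x \<le> T"
    and d: "\<bar>d\<bar> \<le> L"
    and u: "u = (x * solution h x + h x - mean h) / g x"
  shows "\<bar>(solution h x + d + (x - g1 x) * u) / g x\<bar> \<le> (4 + 2 * B * T) / c * L"
proof -
  note pos = g_pos[of x] q_pos[of x] c_pos tail_moment_pos[of x]
  have L: "0 \<le> L" using d by linarith
  have B: "0 \<le> B" using ratio_bound[of 0] by linarith
  have "\<bar>u\<bar> \<le> 2 * L * (lower_area x * upper_area x) / tail_moment x / g x"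
    unfolding u abs_divide using abs_solution_equation_le[OF lip int, of x] pos
    by (simp only: abs_of_pos divide_right_mono less_imp_le)
  also have "\<dots> \<le> 2 * L * (tail_moment x * g x / q x * (tail_moment x + \<bar>x\<bar>)) / tail_moment x / g x"
    using pos L by (intro divide_right_mono mult_left_mono areas_le) auto
  also have "\<dots> = 2 * L * ((tail_moment x + \<bar>x\<bar>) / q x)"
    using pos by simp
  finally have u_le: "\<bar>u\<bar> \<le> 2 * L * ((tail_moment x + \<bar>x\<bar>) / q x)" .
  have "\<bar>(x - g1 x) * u / g x\<bar> = \<bar>x - g1 x\<bar> / g x * \<bar>u\<bar>"
    using pos by (simp add: abs_mult abs_divide)
  also have "\<dots> \<le> \<bar>x - g1 x\<bar> / g x * (2 * L * ((tail_moment x + \<bar>x\<bar>) / q x))"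
    using pos by (intro mult_left_mono u_le) simp
  also have "\<dots> = 2 * L * (\<bar>x - g1 x\<bar> / g x * ((tail_moment x + \<bar>x\<bar>) / q x))"
    by (simp add: mult_ac)
  also have "\<dots> \<le> 2 * L * ((B * tail_moment x + 1) / c)"
    by (intro mult_left_mono deriv_coefficient_bound) (use L in auto)
  also have "\<dots> \<le> 2 * L * ((B * T + 1) / c)"
    using L B pos tail by (intro mult_left_mono divide_right_mono add_right_mono) auto
  finally have 1: "\<bar>(x - g1 x) * u / g x\<bar> \<le> 2 * L * ((B * T + 1) / c)" .
  have 2: "\<bar>(solution h x + d) / g x\<bar> \<le> 2 * L / c"
  proof -
    have "\<bar>solution h x + d\<bar> \<le> 2 * L" using abs_solution_le[OF lip int, of x] d by linarith
    then show ?thesis using pos c_le[of x] L by (simp add: abs_divide frac_le)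
  qed
  have "\<bar>(solution h x + d + (x - g1 x) * u) / g x\<bar> \<le> 2 * L / c + 2 * L * ((B * T + 1) / c)"
    unfolding add_divide_distrib[of "solution h x + d"]
    by (rule order_trans[OF abs_triangle_ineq add_mono[OF 2 1]])
  also have "\<dots> = (4 + 2 * B * T) / c * L"
    by (simp add: divide_simps) (simp add: algebra_simps)
  finally show ?thesis .
qed

end

section \<open>The bound for the Stein solution of a Malliavin differentiable variable\<close>

lemma D12_imp_square_integrable:
  assumes "Z \<in> D12 M W"
  shows "Z \<in> borel_measurable M" "integrable M (\<lambda>\<omega>. (Z \<omega>)\<^sup>2)"
  using assms by (auto simp: D12_def has_malliavin_deriv_def L2_rv_def)

text \<open>With division by zero equal to zero, \<open>g z > 0\<close> rules out \<open>\<rho> z = 0\<close>, so the defining formula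
  of \<open>g\<close> may be multiplied by \<open>\<rho> z\<close>.\<close>

lemma is_g_star_density_facts:
  assumes g: "is_g_star M W Z \<rho> g" and nonneg: "0 \<le> \<rho> z"
  shows "0 < g z" "0 < \<rho> z" "(LBINT y:{z..}. y * \<rho> y) = g z * \<rho> z"
proof -
  have gz: "g z = 1 / \<rho> z * (LBINT y:{z..}. y * \<rho> y)" and pos: "0 < g z"
    using g by (auto simp: is_g_star_def)
  show "0 < g z" by (rule pos)
  have "\<rho> z \<noteq> 0" using gz pos by auto
  then show "0 < \<rho> z" "(LBINT y:{z..}. y * \<rho> y) = g z * \<rho> z"
    using nonneg gz by simp_all
qed

theorem theorem11:
  fixes M :: "'a measure"
    and W :: "'h::{real_inner, banach, second_countable_topology} \<Rightarrow> 'a \<Rightarrow> real"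
    and Z :: "'a \<Rightarrow> real"
    and \<rho> g :: "real \<Rightarrow> real"
  assumes W: "isonormal_gaussian_process M W"
    and Z_D12: "Z \<in> D12 M W"
    and Z_mean: "(\<integral>\<omega>. Z \<omega> \<partial>M) = 0"
    and Z_support: "law_support M Z = UNIV"
    and Z_density: "distributed M lborel Z (\<lambda>x. ennreal (\<rho> x))"
    and \<rho>_nonneg: "\<And>x. \<rho> x \<ge> 0"
    and \<rho>_cont: "continuous_on UNIV \<rho>"
    and g: "is_g_star M W Z \<rho> g"
    and g_liminf_top: "Liminf at_top (\<lambda>x. ereal (g x)) > 0"
    and g_liminf_bot: "Liminf at_bot (\<lambda>x. ereal (g x)) > 0"
    and g_tilde: "\<exists>gt :: real \<Rightarrow> real. (\<forall>x. gt x > 0) \<and> gt C1_differentiable_on UNIV \<and>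
        (\<forall>F\<in>{at_top, at_bot}.
           0 < Liminf F (\<lambda>x. ereal (g x / gt x)) \<and>
           Liminf F (\<lambda>x. ereal (g x / gt x)) \<le> Limsup F (\<lambda>x. ereal (g x / gt x)) \<and>
           Limsup F (\<lambda>x. ereal (g x / gt x)) < \<infinity> \<and>
           (\<exists>l::ereal. ((\<lambda>x. ereal (deriv gt x)) \<longlongrightarrow> l) F))"
    and g_diff: "\<And>x. g differentiable (at x)"
    and g_diff2: "\<And>x. deriv g differentiable (at x)"
    and g_second: "\<And>x. deriv (deriv g) x < 2"
    and bdd_bot: "Bfun (\<lambda>x. \<bar>(x - deriv g x) / (x\<^sup>2 - x * deriv g x + g x)\<bar>) at_bot"
    and bdd_top: "Bfun (\<lambda>x. \<bar>(x - deriv g x) / (x\<^sup>2 - x * deriv g x + g x)\<bar>) at_top"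
  shows "\<exists>k::real. \<forall>h :: real \<Rightarrow> real.
      (\<exists>C. C-lipschitz_on UNIV h) \<longrightarrow> esssup_norm (deriv0 h) < \<infinity> \<longrightarrow>
      (let f = stein_solution M Z \<rho> g h in
        (\<forall>x. f differentiable (at x) \<and>
             g x * deriv f x - x * f x = h x - (\<integral>\<omega>. h (Z \<omega>) \<partial>M)) \<and>
        sup_norm (second_deriv0 f) \<le> ereal k * esssup_norm (deriv0 h))"
proof -
  interpret isonormal_gaussian_process M W by (fact W)
  note Z_measurable[measurable] = D12_imp_square_integrable(1)[OF Z_D12]
  have Z_integrable: "integrable M Z"
    using square_integrable_imp_integrable[OF D12_imp_square_integrable[OF Z_D12]] .
  have expectation_eq: "(\<integral>y. k y * \<rho> y \<partial>lborel) = (\<integral>\<omega>. k (Z \<omega>) \<partial>M)"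
    if "k \<in> borel_measurable borel" for k
    using distributed_integral[OF Z_density, of k] that \<rho>_nonneg by (simp add: mult.commute)
  interpret centred_density \<rho>
  proof
    show "integrable lborel \<rho>" "integrable lborel (\<lambda>y. y * \<rho> y)"
      using distributed_integrable[OF Z_density, of "\<lambda>_. 1"]
        distributed_integrable[OF Z_density, of "\<lambda>y. y"] Z_integrable \<rho>_nonneg
      by (simp_all add: mult.commute)
    show "integral\<^sup>L lborel \<rho> = 1" "(\<integral>y. y * \<rho> y \<partial>lborel) = 0"
      using expectation_eq[of "\<lambda>_. 1"] expectation_eq[of "\<lambda>y. y"]
      by (simp_all add: prob_space Z_mean)
  qed (rule \<rho>_nonneg, rule \<rho>_cont)
  have g_has_deriv: "(g has_real_derivative deriv g x) (at x)"
    and g'_has_deriv: "(deriv g has_real_derivative deriv (deriv g) x) (at x)" for x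
    using g_diff g_diff2 by (simp_all add: DERIV_deriv_iff_real_differentiable)
  interpret smooth_stein_density \<rho> g "deriv g" "deriv (deriv g)"
    by unfold_locales
      (use is_g_star_density_facts[OF g \<rho>_nonneg] g_has_deriv g'_has_deriv g_second in
        \<open>simp_all add: tail_moment_def\<close>)
  have g_cont: "continuous_on UNIV g" and g1_cont: "continuous_on UNIV (deriv g)"
    using g_diff g_diff2
    by (auto intro!: continuous_at_imp_continuous_on differentiable_imp_continuous_within)
  obtain c where c: "0 < c" "\<And>x. c \<le> g x"
    using positive_lower_bound_if_Liminf_pos[OF g_cont g_pos g_liminf_top g_liminf_bot] by blast
  have "x\<^sup>2 - x * deriv g x + g x \<noteq> 0" for x
    using q_pos[of x] unfolding q_def by linarith
  then have "continuous_on UNIV (\<lambda>x. \<bar>(x - deriv g x) / (x\<^sup>2 - x * deriv g x + g x)\<bar>)"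
    by (intro continuous_intros g_cont g1_cont) simp
  then obtain B where B: "\<And>x. \<bar>\<bar>(x - deriv g x) / (x\<^sup>2 - x * deriv g x + g x)\<bar>\<bar> \<le> B"
    using continuous_bounded_if_Bfun_at_ends[OF _ bdd_top bdd_bot] by blast
  have B: "\<bar>(x - deriv g x) / q x\<bar> \<le> B" for x
    using B[of x] unfolding q_def abs_idempotent .
  interpret bounded_stein_density \<rho> g "deriv g" "deriv (deriv g)" B c
    by unfold_locales (use B c in auto)
  define T where "T = (\<integral>y. \<bar>y * \<rho> y\<bar> \<partial>lborel)"
  have T: "tail_moment x \<le> T" for x
    using abs_lower_integral_le[OF moment_integrable, of x] by (simp add: tail_moment_eq T_def)
  define k where "k = (4 + 2 * B * T) / c"
  show ?thesis
  proof (intro exI[of _ k] allI impI)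
    fix h :: "real \<Rightarrow> real"
    assume "\<exists>C. C-lipschitz_on UNIV h" and "esssup_norm (deriv0 h) < \<infinity>"
    then obtain C L where C: "C-lipschitz_on UNIV h" and L: "0 \<le> L" "esssup_norm (deriv0 h) = ereal L"
      and AE: "AE x in lborel. \<bar>deriv0 h x\<bar> \<le> L"
      using esssup_norm_eq_real by metis
    have lip: "\<bar>h y - h x\<bar> \<le> L * \<bar>y - x\<bar>" for x y
      by (rule Lipschitz_bound_from_AE_derivative_bound[OF C AE L(1)])
    have h_cont: "continuous_on UNIV h" using C by (rule lipschitz_on_continuous_on)
    have h_meas: "h \<in> borel_measurable borel" using h_cont by (rule borel_measurable_continuous_onI)
    have int: "integrable lborel (\<lambda>y. h y * \<rho> y)"
      by (rule Lipschitz_integrable[OF lip h_meas])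
    have mean_eq: "(\<integral>\<omega>. h (Z \<omega>) \<partial>M) = mean h"
      using expectation_eq[OF h_meas] by (simp add: mean_def)
    define f where "f = stein_solution M Z \<rho> g h"
    have f: "f = solution h"
      by (rule ext) (simp add: f_def stein_solution_def solution_def numerator_def mean_eq g_density)
    define u where "u x = (x * f x + h x - mean h) / g x" for x
    have f_deriv: "(f has_real_derivative u x) (at x)" for x
      unfolding u_def f by (rule solution_has_derivative[OF int h_cont])
    then have deriv_f: "deriv f = u" by (auto intro: DERIV_imp_deriv)
    have gu: "g x * u x - x * f x = h x - mean h" for x
      using g_pos[of x] by (simp add: u_def)
    have k_nonneg: "0 \<le> k"
    proof -
      have "0 \<le> B" "0 \<le> T" using B[of 0] T[of 0] tail_moment_pos[of 0] by linarith+
      then show ?thesis using c by (simp add: k_def)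
    qed
    have "\<bar>second_deriv0 f x\<bar> \<le> k * L" for x
    proof (cases "(\<forall>\<^sub>F y in nhds x. f differentiable (at y)) \<and> deriv f differentiable (at x)")
      case True
      define D where "D = deriv u x"
      have D: "(u has_real_derivative D) (at x)"
        using True by (simp add: deriv_f D_def DERIV_deriv_iff_real_differentiable)
      \<comment> \<open>The Stein equation writes \<open>h\<close> in terms of \<open>f\<close> and \<open>f'\<close>, so \<open>h\<close> is differentiable wherever \<open>f'\<close> is.\<close>
      define d where "d = deriv g x * u x + g x * D - (f x + x * u x)"
      have "((\<lambda>y. g y * u y - y * f y + mean h) has_real_derivative d) (at x)"
        unfolding d_def by (rule derivative_eq_intros g_deriv f_deriv D refl)+ simp
      then have "(h has_real_derivative d) (at x)" by (simp add: gu)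
      then have d: "\<bar>d\<bar> \<le> L" by (rule abs_derivative_le_Lipschitz_constant[OF lip])
      have "D = (solution h x + d + (x - deriv g x) * u x) / g x"
        using g_pos[of x] by (simp add: d_def f divide_simps) (simp add: algebra_simps)
      also have "\<bar>\<dots>\<bar> \<le> k * L"
        unfolding k_def
        by (rule second_derivative_bound[OF lip int T d]) (simp add: u_def f)
      finally show ?thesis using True by (simp add: second_deriv0_def deriv_f D_def)
    next
      case False
      then show ?thesis using k_nonneg L by (auto simp: second_deriv0_def)
    qed
    then have "sup_norm (second_deriv0 f) \<le> ereal k * esssup_norm (deriv0 h)"
      unfolding sup_norm_def L(2) by (auto intro!: SUP_least)
    moreover have "f differentiable (at x) \<and> g x * deriv f x - x * f x = h x - (\<integral>\<omega>. h (Z \<omega>) \<partial>M)" for x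
      using f_deriv[of x] gu[of x] by (auto simp: deriv_f mean_eq real_differentiable_def)
    ultimately show "let f = stein_solution M Z \<rho> g h in
        (\<forall>x. f differentiable (at x) \<and> g x * deriv f x - x * f x = h x - (\<integral>\<omega>. h (Z \<omega>) \<partial>M)) \<and>
        sup_norm (second_deriv0 f) \<le> ereal k * esssup_norm (deriv0 h)"
      unfolding Let_def f_def by blast
  qed
qed

end
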